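(* Let $0<\epsilon<\frac{1}{64}$ and let $\{x_i\}_{i=1}^m$ be a unit-norm frame for $\mathbb{R}^n$ such that $\|x_i-x_j\|<\epsilon$ for all $i\neq j$. Then $\{x_i\}_{i=1}^m$ is not piecewise scalable with any orthogonal projection of rank $k$, where $2\le k\le n-2$.
   Context: A finite family $\{x_i\}_{i=1}^m$ in $\mathbb{R}^n$ is a frame for $\mathbb{R}^n$ if there are constants $0<A\le B<\infty$ with $A\|x\|^2\le\sum_{i=1}^m|\langle x,x_i\rangle|^2\le B\|x\|^2$ for all $x\in\mathbb{R}^n$; it is unit-norm if all $\|x_i\|=1$, and Parseval if $\sum_{i=1}^m|\langle x,x_i\rangle|^2=\|x\|^2$ for all $x\in\mathbb{R}^n$. An orthogonal projection is a linear map $P$ with $P\circ P=P$ and $P^*=P$. A frame $\{x_i\}_{i=1}^m$ for $\mathbb{R}^n$ is piecewise scalable with an orthogonal projection $P:\mathbb{R}^n\to\mathbb{R}^n$ if there exist real constants $\{a_i,b_i\}_{i=1}^m$ such that $\{a_iPx_i+b_i(I-P)x_i\}_{i=1}^m$ is a Parseval frame for $\mathbb{R}^n$. *)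

theory Defs
  imports "HOL-Analysis.Analysis"
begin

text \<open>Throughout, a function \<open>x :: nat \<Rightarrow> real ^ 'n\<close> together with \<open>m :: nat\<close> stands for the
  finite family \<open>x 1, \<dots>, x m\<close>; the values of \<open>x\<close> outside \<open>{1..m}\<close> are irrelevant.\<close>

definition is_frame :: "nat \<Rightarrow> (nat \<Rightarrow> real ^ 'n) \<Rightarrow> bool" where
  "is_frame m x \<longleftrightarrow>
     (\<exists>A B :: real. 0 < A \<and> A \<le> B \<and>
        (\<forall>v. A * (norm v)\<^sup>2 \<le> (\<Sum>i = 1..m. \<bar>v \<bullet> x i\<bar>\<^sup>2) \<and>
             (\<Sum>i = 1..m. \<bar>v \<bullet> x i\<bar>\<^sup>2) \<le> B * (norm v)\<^sup>2))"

definition unit_norm_frame :: "nat \<Rightarrow> (nat \<Rightarrow> real ^ 'n) \<Rightarrow> bool" where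
  "unit_norm_frame m x \<longleftrightarrow> is_frame m x \<and> (\<forall>i \<in> {1..m}. norm (x i) = 1)"

definition parseval_frame :: "nat \<Rightarrow> (nat \<Rightarrow> real ^ 'n) \<Rightarrow> bool" where
  "parseval_frame m x \<longleftrightarrow>
     is_frame m x \<and> (\<forall>v. (\<Sum>i = 1..m. \<bar>v \<bullet> x i\<bar>\<^sup>2) = (norm v)\<^sup>2)"

definition orthogonal_projection :: "(real ^ 'n \<Rightarrow> real ^ 'n) \<Rightarrow> bool" where
  "orthogonal_projection P \<longleftrightarrow> linear P \<and> P \<circ> P = P \<and> adjoint P = P"

text \<open>The next notion is only meant for a frame \<open>x\<close> and an orthogonal projection \<open>P\<close>;
  these two conditions are not part of the definition and have to be assumed separately.\<close>

definition piecewise_scalable ::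
    "nat \<Rightarrow> (nat \<Rightarrow> real ^ 'n) \<Rightarrow> (real ^ 'n \<Rightarrow> real ^ 'n) \<Rightarrow> bool" where
  "piecewise_scalable m x P \<longleftrightarrow>
     (\<exists>a b :: nat \<Rightarrow> real.
        parseval_frame m (\<lambda>i. a i *\<^sub>R P (x i) + b i *\<^sub>R (x i - P (x i))))"

end

theory Submission
  imports Defs
begin

text \<open>Restricted to the range (or to the kernel) \<open>S\<close> of \<open>P\<close>, a piecewise scaling is an ordinary
  scaling of the family, with coefficients \<open>a\<close> (or \<open>b\<close>). Since \<open>x 1\<close> is a unit vector, one of its
  two components, say \<open>z\<close> in \<open>S\<close>, is much longer than \<open>\<epsilon>\<close>. As \<open>dim S \<ge> 2\<close>, there is a unit vector
  \<open>e\<close> in \<open>S\<close> orthogonal to \<open>z\<close>. All \<open>x i\<close> are within \<open>\<epsilon>\<close> of \<open>x 1\<close>, so each has a smaller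
  component along \<open>e\<close> than along \<open>z\<close>, whereas the Parseval identity gives the weighted sums
  of the squares of these components the same value. The cross terms play no role.\<close>

lemma clustered_family_not_scalable_on_subspace:
  fixes x :: "'i \<Rightarrow> 'a::euclidean_space" and c :: "'i \<Rightarrow> real"
  assumes S: "subspace S" "2 \<le> dim S"
    and z: "z \<in> S" "\<And>v. v \<in> S \<Longrightarrow> v \<bullet> y = v \<bullet> z"
    and \<epsilon>: "0 < \<epsilon>" "2 * \<epsilon> \<le> norm z"
    and close: "\<And>i. i \<in> I \<Longrightarrow> norm (x i - y) < \<epsilon>"
    and "finite I"
  shows "\<not> (\<forall>v\<in>S. (\<Sum>i\<in>I. (c i * (v \<bullet> x i))\<^sup>2) = (norm v)\<^sup>2)"
proof
  assume parseval: "\<forall>v\<in>S. (\<Sum>i\<in>I. (c i * (v \<bullet> x i))\<^sup>2) = (norm v)\<^sup>2"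
  \<comment> \<open>The span of one vector cannot fill \<open>S\<close>, which leaves room in
    \<open>S\<close> for a nonzero vector orthogonal to \<open>z\<close>.\<close>
  have "dim {z} < dim S"
    using S(2) dim_le_card'[of "{z}"] by simp
  moreover have "span {z} \<subseteq> S"
    using S(1) z(1) by (simp add: span_minimal)
  ultimately have "span {z} \<subset> span S"
    using S(1) by (metis dim_span less_irrefl psubsetI span_eq_iff)
  then obtain w where w: "w \<noteq> 0" "w \<in> S" "w \<bullet> z = 0"
    using orthogonal_to_subspace_exists_gen[of "{z}" S] S(1)
    by (metis insertI1 orthogonal_def span_base span_eq_iff)
  define e where "e = w /\<^sub>R norm w"
  define u where "u = z /\<^sub>R norm z"
  have "z \<noteq> 0"
    using \<epsilon> by auto
  have eu: "e \<in> S" "u \<in> S" "norm e = 1" "norm u = 1" "e \<bullet> z = 0"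
    using w z(1) S(1) \<open>z \<noteq> 0\<close> by (auto simp: e_def u_def subspace_scale)
  have "u \<bullet> z = norm z"
    using \<open>z \<noteq> 0\<close> by (simp add: u_def dot_square_norm power2_eq_square)
  have less: "(e \<bullet> x i)\<^sup>2 < (u \<bullet> x i)\<^sup>2" if "i \<in> I" for i
  proof -
    \<comment> \<open>Since \<open>e \<bullet> y = 0\<close> and
      \<open>u \<bullet> y = norm z\<close>, this yields \<open>\<bar>e \<bullet> x i\<bar> <
      \<epsilon> \<le> norm z - \<epsilon> < u \<bullet> x i\<close>; hence the factor 2 in the
      assumption on \<open>norm z\<close>.\<close>
    have "\<bar>v \<bullet> (x i - y)\<bar> < \<epsilon>" if "norm v = 1" for v
      using Cauchy_Schwarz_ineq2[of v "x i - y"] close[OF \<open>i \<in> I\<close>] that by simp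
    then have "\<bar>e \<bullet> x i\<bar> < \<epsilon>" "\<bar>u \<bullet> x i - norm z\<bar> < \<epsilon>"
      using eu z(2) \<open>u \<bullet> z = norm z\<close> by (force simp: inner_diff_right)+
    then have "\<bar>e \<bullet> x i\<bar> < \<bar>u \<bullet> x i\<bar>"
      using \<epsilon> by linarith
    then show ?thesis
      using power_strict_mono[of "\<bar>e \<bullet> x i\<bar>" "\<bar>u \<bullet> x i\<bar>" 2] by simp
  qed
  \<comment> \<open>Both weighted sums equal 1. As every bracket is positive, all \<open>c i\<close>
    vanish, which turns the sums into 0.\<close>
  have "(\<Sum>i\<in>I. (c i)\<^sup>2 * ((u \<bullet> x i)\<^sup>2 - (e \<bullet> x i)\<^sup>2)) = 0"
    using parseval eu by (simp add: right_diff_distrib sum_subtractf flip: power_mult_distrib)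
  moreover have "0 \<le> (c i)\<^sup>2 * ((u \<bullet> x i)\<^sup>2 - (e \<bullet> x i)\<^sup>2)" if "i \<in> I" for i
    using less[OF that] by simp
  ultimately have "\<forall>i\<in>I. (c i)\<^sup>2 * ((u \<bullet> x i)\<^sup>2 - (e \<bullet> x i)\<^sup>2) = 0"
    using sum_nonneg_eq_0_iff[OF \<open>finite I\<close>] by meson
  then have "\<forall>i\<in>I. c i = 0"
    using less by fastforce
  then show False
    using parseval eu by force
qed

theorem theorem4p6:
  fixes \<epsilon> :: real and m :: nat and x :: "nat \<Rightarrow> real ^ 'n"
  assumes "0 < \<epsilon>" and "\<epsilon> < 1 / 64"
    and "unit_norm_frame m x"
    and "\<And>i j. i \<in> {1..m} \<Longrightarrow> j \<in> {1..m} \<Longrightarrow> i \<noteq> j \<Longrightarrow> norm (x i - x j) < \<epsilon>"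
  shows "\<forall>(k::nat) P. 2 \<le> k \<and> k + 2 \<le> CARD('n) \<and> orthogonal_projection P \<and> dim (range P) = k
           \<longrightarrow> \<not> piecewise_scalable m x P"
proof (intro allI impI notI)
  fix k :: nat and P :: "real ^ 'n \<Rightarrow> real ^ 'n"
  assume k: "2 \<le> k \<and> k + 2 \<le> CARD('n) \<and> orthogonal_projection P \<and> dim (range P) = k"
    and "piecewise_scalable m x P"
  then obtain a b where parseval:
    "\<And>v. (\<Sum>i = 1..m. (v \<bullet> (a i *\<^sub>R P (x i) + b i *\<^sub>R (x i - P (x i))))\<^sup>2) = (norm v)\<^sup>2"
    unfolding piecewise_scalable_def parseval_frame_def by auto
  have lin: "linear P" and idem: "\<And>v. P (P v) = P v" and adj: "adjoint P = P"
    using k by (auto simp: orthogonal_projection_def fun_eq_iff)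
  have sym: "v \<bullet> P w = P v \<bullet> w" for v w
    using adjoint_works[OF lin, of v w] adj by simp
  \<comment> \<open>An empty sum cannot give the norm of a unit vector. So \<open>x 1\<close>
    belongs to the family and can serve as its centre.\<close>
  have "m \<noteq> 0"
    using parseval[of "axis undefined 1"] by (intro notI) simp
  then have close: "norm (x i - x 1) < \<epsilon>" if "i \<in> {1..m}" for i
    using assms(1) assms(4)[of i 1] that by (cases "i = 1") auto
  have "norm (x 1) = 1"
    using assms(3) \<open>m \<noteq> 0\<close> by (auto simp: unit_norm_frame_def)
  then have "norm (P (x 1) + (x 1 - P (x 1))) = 1"
    by simp
  \<comment> \<open>The value 1/2 is enough, because \<open>2 * \<epsilon> < 1 / 32\<close>.\<close>
  then have "1 / 2 \<le> norm (P (x 1)) \<or> 1 / 2 \<le> norm (x 1 - P (x 1))"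
    using norm_triangle_ineq[of "P (x 1)" "x 1 - P (x 1)"] by linarith
  then show False
  proof
    assume long: "1 / 2 \<le> norm (P (x 1))"
    have fixed: "P v = v" if "v \<in> range P" for v
      using that idem by auto
    have "(\<Sum>i\<in>{1..m}. (a i * (v \<bullet> x i))\<^sup>2) = (norm v)\<^sup>2" if "v \<in> range P" for v
    proof -
      \<comment> \<open>Consequently \<open>v\<close> is orthogonal to \<open>x i - P (x i)\<close>,
        and the terms with \<open>b\<close> drop out.\<close>
      have "v \<bullet> P (x i) = v \<bullet> x i" for i
        using fixed[OF that] sym[of v "x i"] by simp
      then show ?thesis
        using parseval[of v] by (simp add: inner_add_right inner_diff_right)
    qed
    moreover have "subspace (range P)"
      using lin by (simp add: linear_subspace_image)
    moreover have "v \<bullet> x 1 = v \<bullet> P (x 1)" if "v \<in> range P" for v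
      using fixed[OF that] sym[of v "x 1"] by simp
    ultimately show False
      using clustered_family_not_scalable_on_subspace
          [of "range P" "P (x 1)" "x 1" \<epsilon> "{1..m}" x a] k assms(1,2) close long
      by auto
  next
    assume "1 / 2 \<le> norm (x 1 - P (x 1))"
    moreover have "(\<Sum>i\<in>{1..m}. (b i * (v \<bullet> x i))\<^sup>2) = (norm v)\<^sup>2" if "v \<in> {v. P v = 0}" for v
    proof -
      have "v \<bullet> P (x i) = 0" for i
        using that sym[of v "x i"] by simp
      then show ?thesis
        using parseval[of v] by (simp add: inner_add_right inner_diff_right)
    qed
    moreover have "subspace {v. P v = 0}"
      using lin by (rule linear_subspace_kernel)
    moreover have "2 \<le> dim {v. P v = 0}"
    proof -
      \<comment> \<open>By self-adjointness the kernel is the orthogonal complement of the range, so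
        its dimension is \<open>CARD('n) - k\<close>; the upper bound on \<open>k\<close> makes this
        at least 2.\<close>
      have "{y \<in> UNIV. \<forall>w\<in>range P. orthogonal w y} = {v. P v = 0}"
        by (auto simp: orthogonal_def simp flip: sym) (metis inner_eq_zero_iff sym)
      then show ?thesis
        using dim_subspace_orthogonal_to_vectors[of "range P" UNIV] lin k
        by (simp add: linear_subspace_image)
    qed
    moreover have "P (x 1 - P (x 1)) = 0"
      using idem lin by (simp add: linear_diff)
    moreover have "v \<bullet> x 1 = v \<bullet> (x 1 - P (x 1))" if "v \<in> {v. P v = 0}" for v
      using that sym[of v "x 1"] by (simp add: inner_diff_right)
    ultimately show False
      using clustered_family_not_scalable_on_subspace
          [of "{v. P v = 0}" "x 1 - P (x 1)" "x 1" \<epsilon> "{1..m}" x b] assms(1,2) close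
      by auto
  qed
qed

end
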